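(* Let $k_0\ge 1$ and $\epsilon>0$. Then there exists $n_0=n_0(k_0,\epsilon)$ such that, for all $n\ge n_0$ and $1\le k\le k_0$, the path graph $P_n$ satisfies \[ \sum_{i=1}^{2k}d_i(P_n)- \sum_{i=1}^k \lambda_i(L(P_n))<\epsilon. \]
   Context: $P_n$ is the path graph with $n$ vertices. For a finite simple graph $G$ on $n$ vertices, $d_i(G)$ ($1\le i\le n$) is the $i$-th largest vertex degree of $G$ (with multiplicity); thus $n_0\ge 2k_0$ is implicit, so that the sums make sense. $L(G)$ is the Laplacian matrix of $G$: $L(G)_{u,u}=\deg_G(u)$, $L(G)_{u,v}=-1$ if $\{u,v\}$ is an edge, and $0$ otherwise. For a symmetric real matrix $M$, $\lambda_i(M)$ is its $i$-th largest eigenvalue (with multiplicity). *)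

theory Defs
  imports
    "HOL-Library.Multiset"
    "Graph_Theory.Graph_Theory"
    "Jordan_Normal_Form.Char_Poly"
begin

text \<open>
  A finite simple graph is a \<open>pair_graph\<close>: a finite, loop-free, symmetric set of arcs,
  so that the edge {u, v} appears as the two arcs (u, v) and (v, u). The degree of
  a vertex is therefore its out-degree.
\<close>

definition path_graph :: "nat \<Rightarrow> nat pair_pre_digraph" where
  "path_graph n = \<lparr> pverts = {0..<n},
     parcs = {(u, v). u < n \<and> v < n \<and> (v = u + 1 \<or> u = v + 1)} \<rparr>"

lemma pair_graph_path_graph: "pair_graph (path_graph n)"
proof
  have "parcs (path_graph n) \<subseteq> {0..<n} \<times> {0..<n}"
    by (auto simp: path_graph_def)
  then show "finite (parcs (path_graph n))"
    by (rule finite_subset) simp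
qed (auto simp: path_graph_def sym_def symmetric_def arcs_ends_def arc_to_ends_def with_proj_def)

definition vertex_degree :: "'a pair_pre_digraph \<Rightarrow> 'a \<Rightarrow> nat" where
  "vertex_degree G u = out_degree (with_proj G) u"

text \<open>The index is 1-based and elements are counted with multiplicity; the value is
  meaningful only for \<open>1 \<le> i \<le> size M\<close>.\<close>

definition nth_largest :: "'a::linorder multiset \<Rightarrow> nat \<Rightarrow> 'a" where
  "nth_largest M i = rev (sorted_list_of_multiset M) ! (i - 1)"

definition nth_degree :: "'a pair_pre_digraph \<Rightarrow> nat \<Rightarrow> nat" where
  "nth_degree G i = nth_largest (image_mset (vertex_degree G) (mset_set (pverts G))) i"

text \<open>Rows and columns are indexed by positions in the increasing enumeration of the
  vertices, since the matrices of \<open>Jordan_Normal_Form\<close> are indexed from 0.\<close>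

definition laplacian :: "'a::linorder pair_pre_digraph \<Rightarrow> real mat" where
  "laplacian G = (let vs = sorted_list_of_set (pverts G) in
     mat (length vs) (length vs) (\<lambda>(i, j).
       if i = j then real (vertex_degree G (vs ! i))
       else if (vs ! i, vs ! j) \<in> parcs G then - 1 else 0))"

text \<open>Multiplicity is that of a root of the characteristic polynomial; for a symmetric real
  matrix of dimension n all n roots are real and it equals the dimension of the
  eigenspace.\<close>

definition nth_eigenvalue :: "real mat \<Rightarrow> nat \<Rightarrow> real" where
  "nth_eigenvalue M i = nth_largest (proots (char_poly M)) i"

end

theory Submission
  imports Defs
begin

text \<open>
  Every degree of a path is at most 2, so the degree sum is at most \<open>4k\<close>. The vector
  \<open>v\<^sub>p = cos ((p + 1/2) \<theta>)\<close> with \<open>\<theta> = \<pi> - j\<pi>/n\<close> satisfies \<open>v\<^sub>-\<^sub>1 = v\<^sub>0\<close> and \<open>v\<^sub>n = v\<^sub>n\<^sub>-\<^sub>1\<close>, hence is an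
  eigenvector of the Laplacian for \<open>2 - 2 cos \<theta> = 2 + 2 cos (j\<pi>/n)\<close>. For fixed \<open>k\<close> the \<open>k\<close>
  distinct eigenvalues with \<open>1 \<le> j \<le> k\<close> all tend to 4, so \<open>\<lambda>\<^sub>1, \<dots>, \<lambda>\<^sub>k\<close> do as well.
\<close>

lemma nth_largest_in_mset:
  assumes "1 \<le> i" "i \<le> size M"
  shows "nth_largest M i \<in># M"
proof -
  have "length (rev (sorted_list_of_multiset M)) = size M"
    by (metis length_rev mset_sorted_list_of_multiset size_mset)
  then have "nth_largest M i \<in> set (rev (sorted_list_of_multiset M))"
    unfolding nth_largest_def using assms by (intro nth_mem) simp
  then show ?thesis by simp
qed

text \<open>If the \<open>i\<close>-th largest element were below \<open>c\<close>, all of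
  \<open>S\<close> would lie among the \<open>i - 1\<close> entries before it in the descending
  list, too few for \<open>card S\<close> distinct values. Knowing some elements thus suffices; the
  rest of \<open>M\<close> can only push the entry up.\<close>

lemma nth_largest_ge:
  assumes "S \<subseteq> set_mset M" "1 \<le> i" "i \<le> card S" "\<And>x. x \<in> S \<Longrightarrow> c \<le> x"
  shows "c \<le> nth_largest M i"
proof (rule ccontr)
  define xs where "xs = rev (sorted_list_of_multiset M)"
  assume "\<not> c \<le> nth_largest M i"
  then have less: "xs ! (i - 1) < c"
    by (simp add: nth_largest_def xs_def)
  have set_xs: "set xs = set_mset M"
    by (simp add: xs_def)
  have desc: "sorted_wrt (\<ge>) xs"
    by (simp add: xs_def sorted_wrt_rev)
  have "S \<subseteq> set (take (i - 1) xs)"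
  proof
    fix x assume "x \<in> S"
    then obtain q where q: "q < length xs" "x = xs ! q"
      using assms(1) set_xs by (metis in_set_conv_nth subsetD)
    have "q < i - 1"
    proof (rule ccontr)
      assume "\<not> q < i - 1"
      then have "xs ! q \<le> xs ! (i - 1)"
        using desc q(1) by (cases "q = i - 1") (auto simp: sorted_wrt_iff_nth_less)
      then show False
        using less assms(4)[OF \<open>x \<in> S\<close>] q(2) by simp
    qed
    then show "x \<in> set (take (i - 1) xs)"
      using q by (auto simp: in_set_conv_nth intro!: exI[of _ q])
  qed
  then have "card S \<le> card (set (take (i - 1) xs))"
    by (simp add: card_mono)
  also have "\<dots> \<le> i - 1"
    using card_length[of "take (i - 1) xs"] by simp
  finally show False
    using assms(2,3) by simp
qed

lemma vertex_degree_path_graph: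
  assumes "u < n"
  shows "vertex_degree (path_graph n) u = of_bool (0 < u) + of_bool (u + 1 < n)"
proof -
  have "out_arcs (with_proj (path_graph n)) u =
      (if 0 < u then {(u, u - 1)} else {}) \<union> (if u + 1 < n then {(u, u + 1)} else {})"
    using assms by (auto simp: out_arcs_def path_graph_def with_proj_def)
  then show ?thesis
    by (simp add: vertex_degree_def out_degree_def)
qed

lemma nth_degree_path_graph_le:
  assumes "1 \<le> i" "i \<le> n"
  shows "nth_degree (path_graph n) i \<le> 2"
proof -
  have "nth_degree (path_graph n) i
      \<in># image_mset (vertex_degree (path_graph n)) (mset_set (pverts (path_graph n)))"
    unfolding nth_degree_def using assms
    by (intro nth_largest_in_mset) (auto simp: path_graph_def)
  then obtain u where "u < n" "nth_degree (path_graph n) i = vertex_degree (path_graph n) u"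
    by (auto simp: path_graph_def)
  then show ?thesis
    by (simp add: vertex_degree_path_graph)
qed

lemma laplacian_path_graph:
  "laplacian (path_graph n) = mat n n (\<lambda>(p, q).
     if p = q then of_bool (0 < p) + of_bool (p + 1 < n)
     else if q = p + 1 \<or> p = q + 1 then - 1 else 0)"
proof -
  have vs: "sorted_list_of_set (pverts (path_graph n)) = [0..<n]"
    by (simp add: path_graph_def)
  have arcs: "(u, v) \<in> parcs (path_graph n) \<longleftrightarrow> u < n \<and> v < n \<and> (v = u + 1 \<or> u = v + 1)" for u v
    by (simp add: path_graph_def)
  show ?thesis
    unfolding laplacian_def vs Let_def
    by (rule eq_matI) (auto simp: vertex_degree_path_graph arcs)
qed

lemma laplacian_path_graph_mult_vec:
  assumes "p < n"
  shows "(laplacian (path_graph n) *\<^sub>v vec n v) $ p =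
    of_bool (0 < p) * (v p - v (p - 1)) + of_bool (p + 1 < n) * (v p - v (p + 1))"
proof -
  have "(laplacian (path_graph n) *\<^sub>v vec n v) $ p =
      (\<Sum>q = 0..<n. (if p = q then of_bool (0 < p) + of_bool (p + 1 < n)
        else if q = p + 1 \<or> p = q + 1 then - 1 else 0) * v q)"
    using assms by (simp add: laplacian_path_graph scalar_prod_def)
  \<comment> \<open>For \<open>p = 0\<close> the truncated \<open>p - 1\<close> is \<open>p\<close>
    itself, so the left-neighbour term keeps its \<open>of_bool\<close> factor. The term at
    \<open>p + 1\<close> drops out by itself when that index leaves the range.\<close>
  also have "\<dots> = (\<Sum>q = 0..<n.
      (if q = p then (of_bool (0 < p) + of_bool (p + 1 < n)) * v q else 0)
      - (if q = p + 1 then v q else 0)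
      - (if q = p - 1 then of_bool (0 < p) * v q else 0))"
    by (rule sum.cong) auto
  also have "\<dots> = of_bool (0 < p) * (v p - v (p - 1)) + of_bool (p + 1 < n) * (v p - v (p + 1))"
    using assms by (auto simp: sum_subtractf sum.distrib algebra_simps)
  finally show ?thesis .
qed

lemma eigenvalue_laplacian_path_graph:
  assumes "0 < j" "j < n"
  shows "eigenvalue (laplacian (path_graph n)) (2 + 2 * cos (real j * pi / real n))"
proof -
  \<comment> \<open>Subtracting from \<open>pi\<close> makes small \<open>j\<close> give the
    eigenvalues near 4.\<close>
  define \<theta> where "\<theta> = pi - real j * pi / real n"
  define v where "v = (\<lambda>p::nat. cos ((real p + 1 / 2) * \<theta>))"
  have n\<theta>: "real n * \<theta> = real (n - j) * pi"
    using assms by (simp add: \<theta>_def field_simps of_nat_diff)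
  have cos_step: "2 * cos x - cos (x - \<theta>) - cos (x + \<theta>) = (2 - 2 * cos \<theta>) * cos x" for x
    by (simp add: cos_add cos_diff algebra_simps)
  have three_term: "2 * v (Suc p) - v p - v (Suc (Suc p)) = (2 - 2 * cos \<theta>) * v (Suc p)" for p
  proof -
    have "v p = cos ((real (Suc p) + 1 / 2) * \<theta> - \<theta>)"
      "v (Suc (Suc p)) = cos ((real (Suc p) + 1 / 2) * \<theta> + \<theta>)"
      by (simp_all add: v_def algebra_simps)
    then show ?thesis
      using cos_step[of "(real (Suc p) + 1 / 2) * \<theta>"] by (simp only: v_def)
  qed
  \<comment> \<open>The half shift makes the phantom entry at index -1 equal to \<open>v 0\<close>,
    since cosine is even.\<close>
  have left: "v 0 - v 1 = (2 - 2 * cos \<theta>) * v 0"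
  proof -
    have "\<theta> / 2 - \<theta> = - (\<theta> / 2)"
      by simp
    then have "cos (\<theta> / 2 - \<theta>) = cos (\<theta> / 2)"
      by (simp only: cos_minus)
    moreover have "v 0 = cos (\<theta> / 2)" "v 1 = cos (\<theta> / 2 + \<theta>)"
      by (simp_all add: v_def algebra_simps)
    ultimately show ?thesis
      using cos_step[of "\<theta> / 2"] by simp
  qed
  \<comment> \<open>The two angles lie symmetrically about \<open>real n * \<theta>\<close>, a
    multiple of \<open>pi\<close>, where the sine vanishes.\<close>
  have right: "v (Suc p) = v p" if "n = Suc p" for p
  proof -
    have "v (Suc p) = cos (real n * \<theta> + \<theta> / 2)" "v p = cos (real n * \<theta> - \<theta> / 2)"
      using that by (simp_all add: v_def algebra_simps)
    then show ?thesis
      unfolding n\<theta> by (simp add: cos_add cos_diff sin_npi)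
  qed
  have "(laplacian (path_graph n) *\<^sub>v vec n v) $ p = (2 - 2 * cos \<theta>) * v p" if "p < n" for p
  proof (cases p)
    \<comment> \<open>Here \<open>0 < j < n\<close> forces \<open>n\<close> to be at least 2, so
      vertex 0 has a right neighbour.\<close>
    case 0
    with assms left show ?thesis
      by (subst laplacian_path_graph_mult_vec) auto
  next
    case (Suc q)
    with that three_term[of q] right[of p] show ?thesis
      by (subst laplacian_path_graph_mult_vec) (auto simp: not_less_eq less_Suc_eq)
  qed
  then have "laplacian (path_graph n) *\<^sub>v vec n v = (2 - 2 * cos \<theta>) \<cdot>\<^sub>v vec n v"
    by (intro eq_vecI) (auto simp: laplacian_path_graph)
  moreover have "vec n v \<noteq> 0\<^sub>v n"
  proof -
    \<comment> \<open>The strict bound comes from \<open>0 < j\<close>; at \<theta> =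
      \<open>pi\<close> the vector would vanish identically.\<close>
    have "0 \<le> \<theta>" "\<theta> < pi"
      using assms by (auto simp: \<theta>_def field_simps)
    then have "0 < v 0"
      unfolding v_def by (intro cos_gt_zero_pi) auto
    then show ?thesis
      using assms by (metis index_vec index_zero_vec(1) less_irrefl less_trans)
  qed
  ultimately have "eigenvalue (laplacian (path_graph n)) (2 - 2 * cos \<theta>)"
    unfolding eigenvalue_def eigenvector_def
    by (intro exI[of _ "vec n v"]) (simp add: laplacian_path_graph)
  then show ?thesis
    by (simp add: \<theta>_def)
qed

text \<open>Cosine is strictly decreasing on [0, \<open>pi\<close>], so \<open>j = 1, ..., k\<close>
  give \<open>k\<close> distinct eigenvalues, the least at \<open>j = k\<close>. Keeping
  \<open>k\<close> separate from \<open>i\<close> yields one bound for all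
  \<open>i \<le> k\<close>.\<close>

lemma nth_eigenvalue_laplacian_path_graph_ge:
  assumes "1 \<le> i" "i \<le> k" "k < n"
  shows "2 + 2 * cos (real k * pi / real n) \<le> nth_eigenvalue (laplacian (path_graph n)) i"
proof -
  define f where "f = (\<lambda>j::nat. 2 + 2 * cos (real j * pi / real n))"
  have carrier: "laplacian (path_graph n) \<in> carrier_mat n n"
    by (simp add: laplacian_path_graph)
  have range: "0 \<le> real j * pi / real n" "real j * pi / real n \<le> pi" if "j \<le> k" for j
    using that assms by (auto simp: field_simps)
  have "inj_on f {1..k}"
  proof (rule inj_onI)
    fix a b assume "a \<in> {1..k}" "b \<in> {1..k}" "f a = f b"
    then have "real a * pi / real n = real b * pi / real n"
      using range[of a] range[of b] cos_inj_pi[of "real a * pi / real n" "real b * pi / real n"]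
      by (simp add: f_def)
    then show "a = b"
      using assms by simp
  qed
  then have card: "card (f ` {1..k}) = k"
    by (simp add: card_image)
  have "char_poly (laplacian (path_graph n)) \<noteq> 0"
    using degree_monic_char_poly[OF carrier] by auto
  moreover have "poly (char_poly (laplacian (path_graph n))) (f j) = 0" if "j \<in> {1..k}" for j
    unfolding f_def using that assms(3)
    by (subst eigenvalue_root_char_poly[OF carrier, symmetric], intro eigenvalue_laplacian_path_graph) auto
  ultimately have "f ` {1..k} \<subseteq> set_mset (proots (char_poly (laplacian (path_graph n))))"
    by auto
  moreover have "f k \<le> x" if "x \<in> f ` {1..k}" for x
    using that range range[of k] assms
    by (auto simp: f_def divide_right_mono intro!: cos_monotone_0_pi_le)
  ultimately have "f k \<le> nth_eigenvalue (laplacian (path_graph n)) i"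
    unfolding nth_eigenvalue_def using assms(1,2) card by (intro nth_largest_ge) auto
  then show ?thesis
    by (simp add: f_def)
qed

theorem proposition3p7:
  fixes k0 :: nat and \<epsilon> :: real
  assumes "k0 \<ge> 1" and "\<epsilon> > 0"
  shows "\<exists>n0 \<ge> 2 * k0. \<forall>n \<ge> n0. \<forall>k. 1 \<le> k \<and> k \<le> k0 \<longrightarrow>
    (\<Sum>i = 1..2 * k. real (nth_degree (path_graph n) i))
      - (\<Sum>i = 1..k. nth_eigenvalue (laplacian (path_graph n)) i) < \<epsilon>"
proof -
  have "(\<lambda>n. real k0 * pi / real n) \<longlonglongrightarrow> 0"
    by (rule lim_const_over_n)
  then have "(\<lambda>n. 2 + 2 * cos (real k0 * pi / real n)) \<longlonglongrightarrow> 2 + 2 * cos 0"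
    by (intro tendsto_intros)
  \<comment> \<open>The tolerance \<epsilon> is shared among at most \<open>k0\<close>
    eigenvalues.\<close>
  then have "\<forall>\<^sub>F n in sequentially. 4 - \<epsilon> / real k0 < 2 + 2 * cos (real k0 * pi / real n)"
    using assms by (intro order_tendstoD(1)) auto
  then obtain N where N: "4 - \<epsilon> / real k0 < 2 + 2 * cos (real k0 * pi / real n)" if "n \<ge> N" for n
    by (auto simp: eventually_sequentially)
  show ?thesis
  \<comment> \<open>The bound \<open>2 * k0\<close> keeps the degree indices within \<open>n\<close>
    and, as \<open>k0 \<ge> 1\<close>, gives \<open>k0 < n\<close>.\<close>
  proof (intro exI[of _ "max N (2 * k0)"] conjI allI impI)
    fix n k assume n: "max N (2 * k0) \<le> n" and k: "1 \<le> k \<and> k \<le> k0"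
    have "(\<Sum>i = 1..2 * k. real (nth_degree (path_graph n) i)) \<le> (\<Sum>i = 1..2 * k. 2)"
      using n k nth_degree_path_graph_le[of _ n] by (intro sum_mono) force
    moreover have "(\<Sum>i = 1..k. 4 - \<epsilon> / real k0)
        < (\<Sum>i = 1..k. nth_eigenvalue (laplacian (path_graph n)) i)"
    \<comment> \<open>The eigenvalue bound is used at \<open>k0\<close>, uniformly in
      \<open>k\<close>. The sum is nonempty as \<open>1 \<le> k\<close>, and this strict inequality
      makes the final one strict.\<close>
    proof (rule sum_strict_mono)
      fix i assume "i \<in> {1..k}"
      then have "2 + 2 * cos (real k0 * pi / real n) \<le> nth_eigenvalue (laplacian (path_graph n)) i"
        using n k assms by (intro nth_eigenvalue_laplacian_path_graph_ge) auto
      with N[of n] n show "4 - \<epsilon> / real k0 < nth_eigenvalue (laplacian (path_graph n)) i"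
        by simp
    qed (use k in auto)
    moreover have "real k * (\<epsilon> / real k0) \<le> \<epsilon>"
      using k assms by (simp add: field_simps)
    ultimately show "(\<Sum>i = 1..2 * k. real (nth_degree (path_graph n) i))
        - (\<Sum>i = 1..k. nth_eigenvalue (laplacian (path_graph n)) i) < \<epsilon>"
      by (simp add: algebra_simps)
  qed simp
qed

end
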